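(* Let $N$ be a positive integer, not a perfect square, with $N\equiv 1\pmod 4$, and let $\{x_i\}_{i\in\mathbb{Z}}$ be the two-sided continued fraction of the normalized square root $x_0=\alpha$ of $N$, with associated integers $P_i,Q_i$ ($i\in\mathbb{Z}$) as defined in the context. Let $\pi$ be the period of this sequence, i.e. the smallest positive integer with $x_{i+\pi}=x_i$ for all $i\in\mathbb{Z}$, and let $s=\lfloor \pi/2\rfloor$. If $\pi$ is even, then (a) $Q_{s+i}=Q_{s-i}$ for all $i\in\mathbb{Z}$; (b) $Q_s\neq Q_0$; (c) $P_s=P_{s-1}$; (d) $Q_s\mid 2N$. If $\pi$ is odd, then $Q_{s+i+1}=Q_{s-i}$ for all $i\in\mathbb{Z}$, and either (a) $\gcd(Q_s,N)$ is a nontrivial factor of $N$, or (b) $-1$ is a quadratic residue modulo $N$.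
   Context: Normalized square root of $N$: $\alpha=\frac{\sqrt{N}+\lfloor\sqrt{N}\rfloor-1}{2}$ if $\lfloor\sqrt{N}\rfloor$ is even, and $\alpha=\frac{\sqrt{N}+\lfloor\sqrt{N}\rfloor}{2}$ if $\lfloor\sqrt{N}\rfloor$ is odd. Forward terms: $x_0=\alpha$, $b_i=\lfloor x_i\rfloor$, $x_{i+1}=\frac{1}{x_i-b_i}$ for $i\ge 0$. Each $x_i$ is written uniquely as $x_i=\frac{\sqrt{N}+P_{i-1}}{Q_i}$ with $P_{i-1},Q_i$ integers (in particular $Q_0=2$). Backward terms: the expansion is continued to negative indices by running the same recursion in reverse. Namely, put $y_0=\frac{\sqrt{N}+P_0}{Q_0}$ and $y_j=\frac{1}{y_{j-1}-\lfloor y_{j-1}\rfloor}$ for $j\ge 1$; write $y_j=\frac{\sqrt{N}+P_{-j}}{Q_{-j}}$, which defines $P_{-j},Q_{-j}$ for $j\ge 1$ (for $j=1$ this value of $P_{-1}$ agrees with the one given by $x_0$). Then $x_{-j}=\frac{\sqrt{N}+P_{-j-1}}{Q_{-j}}$ for $j\ge 1$. The sequence $\{x_i\}_{i\in\mathbb{Z}}$ is the two-sided continued fraction of $x_0$; it is periodic, i.e. there is a positive integer $\pi$ with $x_{i+\pi}=x_i$ for all $i\in\mathbb{Z}$. *)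

theory Defs
  imports Complex_Main "HOL-Number_Theory.Number_Theory"
begin

definition norm_sqrt :: "nat \<Rightarrow> real" where
  "norm_sqrt N =
     (if even \<lfloor>sqrt (real N)\<rfloor>
      then (sqrt (real N) + of_int \<lfloor>sqrt (real N)\<rfloor> - 1) / 2
      else (sqrt (real N) + of_int \<lfloor>sqrt (real N)\<rfloor>) / 2)"

definition cf_step :: "real \<Rightarrow> real" where
  "cf_step z = 1 / (z - of_int \<lfloor>z\<rfloor>)"

text \<open>
  The pair of integers \<open>(P, Q)\<close> with \<open>z = (sqrt N + P) / Q\<close>. The condition \<open>Q \<noteq> 0\<close> is explicit
  because division by zero yields \<open>0\<close>. For \<open>N\<close> not a square there is at most one such pair.
\<close>

definition surd_pair :: "nat \<Rightarrow> real \<Rightarrow> int \<times> int" where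
  "surd_pair N z = (THE (P, Q). Q \<noteq> 0 \<and> z = (sqrt (real N) + of_int P) / of_int Q)"

definition fwd :: "nat \<Rightarrow> nat \<Rightarrow> real" where
  "fwd N i = (cf_step ^^ i) (norm_sqrt N)"

text \<open>
  The index of \<open>P\<close> is shifted: the forward term with index \<open>i\<close> is \<open>(sqrt N + P (i - 1)) / Q i\<close>,
  whereas the term \<open>bwd N j\<close> of the reversed expansion is \<open>(sqrt N + P (- j)) / Q (- j)\<close>.
  So \<open>bwd\<close> starts with \<open>P 0\<close>, taken from the forward term with index \<open>1\<close>, over \<open>Q 0\<close>, taken from
  the forward term with index \<open>0\<close>.
\<close>

definition bwd :: "nat \<Rightarrow> nat \<Rightarrow> real" where
  "bwd N j = (cf_step ^^ j)
     ((sqrt (real N) + of_int (fst (surd_pair N (fwd N 1)))) / of_int (snd (surd_pair N (fwd N 0))))"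

text \<open>
  \<open>P (- 1)\<close> could be read off from either expansion, and the two values agree; it is taken here from
  the forward one.
\<close>

definition cfP :: "nat \<Rightarrow> int \<Rightarrow> int" where
  "cfP N i = (if i \<ge> - 1 then fst (surd_pair N (fwd N (nat (i + 1))))
              else fst (surd_pair N (bwd N (nat (- i)))))"

definition cfQ :: "nat \<Rightarrow> int \<Rightarrow> int" where
  "cfQ N i = (if i \<ge> 0 then snd (surd_pair N (fwd N (nat i)))
              else snd (surd_pair N (bwd N (nat (- i)))))"

definition cfx :: "nat \<Rightarrow> int \<Rightarrow> real" where
  "cfx N i = (if i \<ge> 0 then fwd N (nat i)
              else (sqrt (real N) + of_int (cfP N (i - 1))) / of_int (cfQ N i))"

definition cf_period :: "nat \<Rightarrow> nat" where
  "cf_period N = (LEAST p. 0 < p \<and> (\<forall>i::int. cfx N (i + int p) = cfx N i))"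

end

theory Submission
  imports Defs
begin

text \<open>
  Write \<open>x\<^sub>i = (sqrt N + p) / q\<close> and encode it by the pair \<open>(p, q)\<close>. One step of the continued
  fraction is the composition of two involutions of the finite set of reduced pairs: \<open>\<sigma>\<close>, which
  replaces \<open>p\<close> by \<open>b q - p\<close> where \<open>b\<close> is the partial quotient, and \<open>\<tau>\<close>, which replaces \<open>q\<close> by
  \<open>(N - p\<^sup>2) / q\<close>. The pair of \<open>\<alpha>\<close> is a fixed point of \<open>\<sigma>\<close>, so the orbit \<open>a\<^sub>i\<close> of this dihedral
  action satisfies \<open>\<sigma> a\<^sub>i = a\<^bsub>-i\<^esub>\<close> and \<open>\<tau> a\<^sub>i = a\<^bsub>1-i\<^esub>\<close>. If the period \<open>2 s\<close> is even, \<open>a\<^sub>s\<close> is a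
  fixed point of \<open>\<sigma>\<close>, that is \<open>2 p = b q\<close>; if the period \<open>2 s + 1\<close> is odd, \<open>a\<^bsub>s+1\<^esub>\<close> is a fixed
  point of \<open>\<tau>\<close>, that is \<open>N = p\<^sup>2 + q\<^sup>2\<close>.
\<close>

section \<open>Orbits of a dihedral action\<close>

locale dihedral_orbit =
  fixes A :: "'a set" and \<sigma> \<tau> :: "'a \<Rightarrow> 'a" and z :: 'a
  assumes finite_A: "finite A"
    and sigma_closed: "x \<in> A \<Longrightarrow> \<sigma> x \<in> A"
    and tau_closed: "x \<in> A \<Longrightarrow> \<tau> x \<in> A"
    and sigma_sigma: "x \<in> A \<Longrightarrow> \<sigma> (\<sigma> x) = x"
    and tau_tau: "x \<in> A \<Longrightarrow> \<tau> (\<tau> x) = x"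
    and base_in: "z \<in> A"
    and sigma_base: "\<sigma> z = z"
begin

definition fw :: "nat \<Rightarrow> 'a" where
  "fw n = ((\<lambda>x. \<tau> (\<sigma> x)) ^^ n) z"

text \<open>Negative indices are filled in by reflection instead of by inverting the step;
  \<open>sigma_base\<close> makes the reflection law hold at 0 too.\<close>

definition orb :: "int \<Rightarrow> 'a" where
  "orb i = (if i \<ge> 0 then fw (nat i) else \<sigma> (fw (nat (- i))))"

lemma fw_0: "fw 0 = z"
  by (simp add: fw_def)

lemma fw_Suc: "fw (Suc n) = \<tau> (\<sigma> (fw n))"
  by (simp add: fw_def)

lemma fw_in: "fw n \<in> A"
  by (induction n) (simp_all add: fw_0 fw_Suc base_in sigma_closed tau_closed)

lemma orb_in: "orb i \<in> A"
  by (simp add: orb_def fw_in sigma_closed)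

lemma orb_0: "orb 0 = z"
  by (simp add: orb_def fw_0)

lemma orb_of_nat: "orb (int n) = fw n"
  by (simp add: orb_def)

lemma sigma_orb: "\<sigma> (orb i) = orb (- i)"
  by (cases "i = 0") (auto simp: orb_def fw_in sigma_sigma fw_0 sigma_base)

text \<open>For i < 0 the step has to be reconciled with the reflection: \<open>\<sigma>\<close>
  leads to \<open>fw (Suc n)\<close>, whose outermost \<open>\<tau>\<close> is then
  cancelled.\<close>

lemma tau_sigma_orb: "\<tau> (\<sigma> (orb i)) = orb (i + 1)"
proof (cases "i \<ge> 0")
  case True
  then have "nat (i + 1) = Suc (nat i)" by simp
  with True show ?thesis by (simp add: orb_def fw_Suc)
next
  case False
  define n where "n = nat (- i - 1)"
  have i: "i = - int (Suc n)" using False by (simp add: n_def)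
  have "\<tau> (\<sigma> (orb i)) = \<tau> (orb (int (Suc n)))"
    by (subst sigma_orb) (simp add: i add.commute)
  also have "\<dots> = \<tau> (fw (Suc n))"
    by (simp only: orb_of_nat)
  also have "\<dots> = \<sigma> (orb (int n))"
    by (simp add: fw_Suc tau_tau sigma_closed fw_in orb_of_nat)
  also have "\<dots> = orb (i + 1)"
    by (subst sigma_orb) (simp add: i)
  finally show ?thesis .
qed

lemma tau_orb: "\<tau> (orb i) = orb (1 - i)"
  using tau_sigma_orb[of "- i"] by (simp add: sigma_orb)

text \<open>The step is invertible, with inverse \<open>\<sigma>\<close> after
  \<open>\<tau>\<close>, so a coincidence propagates in both directions.\<close>

lemma orb_shift:
  assumes "orb i = orb j"
  shows "orb (i + k) = orb (j + k)"
proof (induction k rule: int_induct[where k = 0])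
  case (step1 k)
  then show ?case using tau_sigma_orb[of "i + k"] tau_sigma_orb[of "j + k"]
    by (simp add: add.assoc)
next
  case (step2 k)
  have "\<sigma> (\<tau> (orb l)) = orb (l - 1)" for l
    by (simp add: tau_orb sigma_orb)
  from this[of "i + k"] this[of "j + k"] step2 show ?case
    by (simp add: add_diff_eq)
qed (simp add: assms)

text \<open>Pigeonhole gives two equal terms; shifting both back by k turns this into a return to
  \<open>z\<close> itself.\<close>

lemma ex_period: "\<exists>m>0. orb (int m) = z"
proof -
  have "finite (range (\<lambda>n. orb (int n)))"
    by (rule finite_subset[OF _ finite_A]) (auto simp: orb_in)
  then have "\<not> inj (\<lambda>n. orb (int n))"
    using finite_imageD infinite_UNIV_nat by blast
  then obtain k l where "k < l" "orb (int k) = orb (int l)"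
    unfolding inj_def by (metis linorder_neqE_nat)
  with orb_shift[of "int l" "int k" "- int k"] have "orb (int (l - k)) = z" "l - k > 0"
    by (simp_all add: orb_0 of_nat_diff)
  then show ?thesis by blast
qed

text \<open>By \<open>period_iff\<close>, this first return time is also the least period of the
  two-sided orbit.\<close>

definition per :: nat where
  "per = (LEAST m. 0 < m \<and> orb (int m) = z)"

lemma per_pos: "per > 0" and orb_per: "orb (int per) = z"
  using LeastI_ex[OF ex_period] by (simp_all add: per_def)

lemma per_least: "orb (int m) = z \<Longrightarrow> 0 < m \<Longrightarrow> per \<le> m"
  by (simp add: per_def Least_le)

lemma orb_add_per: "orb (i + int per) = orb i"
  using orb_shift[of "int per" 0 i] by (simp add: orb_per orb_0 add.commute)

lemma period_iff: "(\<forall>i. orb (i + int m) = orb i) \<longleftrightarrow> orb (int m) = z"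
  using orb_shift[of "int m" 0] by (auto simp: orb_0 add.commute dest: spec[of _ 0])

text \<open>Reflection about 0 followed by translation by the period is reflection about half the
  period.\<close>

lemma orb_reflect_even:
  assumes "int per = 2 * s"
  shows "\<sigma> (orb (s - i)) = orb (s + i)"
  using orb_add_per[of "i - s"] assms by (simp add: sigma_orb algebra_simps)

lemma orb_reflect_odd:
  assumes "int per = 2 * s + 1"
  shows "\<sigma> (orb (s - i)) = orb (s + i + 1)"
  using orb_add_per[of "i - s"] assms by (simp add: sigma_orb algebra_simps)

end

section \<open>Reduced surds\<close>

locale reduced_surds =
  fixes N :: nat
  assumes nonsquare: "\<nexists>k::nat. N = k\<^sup>2"
    and one_mod_4: "[N = 1] (mod 4)"
begin

abbreviation r :: real where "r \<equiv> sqrt (real N)"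

lemma N_gt_1: "N > 1"
proof (rule ccontr)
  assume "\<not> N > 1"
  then have "N = N\<^sup>2" by (cases "N = 0") (auto simp: not_less le_Suc_eq)
  then show False using nonsquare by blast
qed

lemma r_pos: "r > 0" and r_sq: "r * r = real N" and r_le: "r \<le> real N"
proof -
  show "r > 0" "r * r = real N" using N_gt_1 by simp_all
  have "real N \<le> real N ^ 2" using N_gt_1 by (simp add: power2_eq_square)
  then show "r \<le> real N" by (simp add: real_le_lsqrt)
qed

lemma r_irrational: "r \<notin> \<rat>"
proof
  assume "r \<in> \<rat>"
  then obtain m n :: nat where mn: "n \<noteq> 0" "\<bar>r\<bar> = real m / real n" "coprime m n"
    by (rule Rats_abs_nat_div_natE)
  then have "r * real n = real m" using r_pos by (simp add: field_simps)
  then have "real m * real m = (r * r) * real n * real n" by (simp flip: \<open>r * real n = real m\<close>)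
  then have eq: "m\<^sup>2 = N * n\<^sup>2"
    unfolding r_sq by (simp add: power2_eq_square mult.assoc flip: of_nat_mult)
  then have "n\<^sup>2 dvd m\<^sup>2" by simp
  then have "n dvd m" by simp
  then have "n = 1" using mn(3) by (metis coprime_common_divisor_nat dvd_refl)
  then have "N = m\<^sup>2" using eq by simp
  then show False using nonsquare by blast
qed

section \<open>Uniqueness of the coordinates of a surd\<close>

definition surd :: "int \<times> int \<Rightarrow> real" where
  "surd a = (r + of_int (fst a)) / of_int (snd a)"

lemma surd_inj:
  assumes "q \<noteq> 0" "q' \<noteq> 0" "surd (p, q) = surd (p', q')"
  shows "p = p' \<and> q = q'"
proof -
  have *: "r * of_int (q' - q) = of_int (p' * q - p * q')"
    using assms by (simp add: surd_def field_simps)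
  have "q' = q"
  proof (rule ccontr)
    assume "q' \<noteq> q"
    then have "r = of_int (p' * q - p * q') / of_int (q' - q)"
      using * by (simp add: nonzero_eq_divide_eq)
    then have "r \<in> \<rat>" by (metis Rats_divide Rats_of_int)
    then show False using r_irrational by blast
  qed
  then show ?thesis using assms by (simp add: surd_def)
qed

lemma surd_pair_surd:
  assumes "snd a \<noteq> 0"
  shows "surd_pair N (surd a) = a"
  unfolding surd_pair_def
proof (rule the_equality)
  show "case a of (P, Q) \<Rightarrow> Q \<noteq> 0 \<and> surd a = (r + real_of_int P) / real_of_int Q"
    using assms by (simp add: surd_def case_prod_beta)
next
  fix c :: "int \<times> int"
  assume c: "case c of (P, Q) \<Rightarrow> Q \<noteq> 0 \<and> surd a = (r + real_of_int P) / real_of_int Q"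
  obtain P Q where cPQ: "c = (P, Q)" by force
  with c have "Q \<noteq> 0" "surd (fst a, snd a) = surd (P, Q)"
    by (auto simp: surd_def)
  with surd_inj[of "snd a" Q "fst a" P] assms cPQ show "c = a"
    by (simp add: prod_eq_iff)
qed

section \<open>Reduced pairs and the two involutions\<close>

text \<open>The inequalities say that the surd exceeds 1 and its conjugate lies in (-1, 0), the
  classical notion of reduced. With q = 2 a, the divisibility says that the surd is a root of an
  integral polynomial a X^2 - p X + c of discriminant N.\<close>

definition reduced :: "(int \<times> int) set" where
  "reduced = {(p, q). 0 < q \<and> odd p \<and> even q \<and> 2 * q dvd int N - p\<^sup>2 \<and>
     of_int p < r \<and> r - of_int p < of_int q \<and> of_int q < r + of_int p}"

text \<open>On reduced surds x with conjugate x', \<open>sg\<close> is the map from x to floor(x) -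
  x', and \<open>ta\<close> is the map from x to -1 / x'.\<close>

definition sg :: "int \<times> int \<Rightarrow> int \<times> int" where
  "sg a = (\<lfloor>surd a\<rfloor> * snd a - fst a, snd a)"

definition ta :: "int \<times> int \<Rightarrow> int \<times> int" where
  "ta a = (fst a, (int N - (fst a)\<^sup>2) div snd a)"

text \<open>The two bounds on q together force p > 0, and \<open>r_le\<close> supplies the integer
  box.\<close>

lemma finite_reduced: "finite reduced"
proof (rule finite_subset)
  show "reduced \<subseteq> {0..int N} \<times> {0..2 * int N}"
  proof (unfold reduced_def, clarify, unfold mem_Times_iff atLeastAtMost_iff fst_conv snd_conv)
    fix p q :: int
    assume "0 < q" "real_of_int p < r" "r - real_of_int p < real_of_int q"
      "real_of_int q < r + real_of_int p"
    then have "real_of_int p < real_of_int (int N)" "real_of_int q < real_of_int (2 * int N)"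
      "0 < real_of_int p"
      using r_le by simp_all
    then have "p < int N" "q < 2 * int N" "0 < p" by (simp_all only: of_int_less_iff of_int_0_less_iff)
    with \<open>0 < q\<close> show "(0 \<le> p \<and> p \<le> int N) \<and> 0 \<le> q \<and> q \<le> 2 * int N"
      by linarith
  qed
qed simp

lemma sg_reduced:
  assumes "a \<in> reduced"
  shows "sg a \<in> reduced" "sg (sg a) = a"
proof -
  obtain p q where a: "a = (p, q)" by force
  define b where "b = \<lfloor>surd a\<rfloor>"
  define p' where "p' = b * q - p"
  have red: "0 < q" "odd p" "even q" "2 * q dvd int N - p\<^sup>2" "of_int p < r"
      "r - of_int p < of_int q" "of_int q < r + of_int p"
    using assms by (auto simp: a reduced_def)
  have s: "surd a * of_int q = r + of_int p" using red by (simp add: surd_def a)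
  have "of_int b \<le> surd a" "surd a < of_int b + 1" by (simp_all add: b_def)
  then have bq: "of_int b * of_int q \<le> r + of_int p" "r + of_int p < (of_int b + 1) * of_int q"
    unfolding s[symmetric] using red(1) by simp_all
  have "surd a > 1" using red by (simp add: surd_def a)
  then have b1: "b \<ge> 1" by (simp add: b_def)
  have "of_int p' \<noteq> r" using r_irrational by (metis Rats_of_int)
  then have p'r: "of_int p' < r" using bq(1) by (simp add: p'_def)
  have low: "r - of_int p' < of_int q" using bq(2) by (simp add: p'_def algebra_simps)
  have "q \<le> b * q" using b1 red(1) by simp
  then have "real_of_int q \<le> of_int b * of_int q" by (simp flip: of_int_mult)
  then have up: "of_int q < r + of_int p'" using red(5) by (simp add: p'_def)
  \<comment> \<open>Since q is even, 2 q divides b q (b q - 2 p), which is the difference of N - p^2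
    and N - p'^2.\<close>
  have "2 dvd b * q - 2 * p" using red(3) by simp
  then have "q * 2 dvd q * (b * q - 2 * p)" by (rule mult_dvd_mono[OF dvd_refl])
  then have "2 * q dvd b * (q * (b * q - 2 * p))"
    unfolding mult.commute[of 2 q] by (rule dvd_mult)
  with red(4) have "2 * q dvd (int N - p\<^sup>2) - b * (q * (b * q - 2 * p))" by (rule dvd_diff)
  also have "(int N - p\<^sup>2) - b * (q * (b * q - 2 * p)) = int N - p'\<^sup>2"
    by (simp add: p'_def power2_eq_square algebra_simps)
  finally have dv: "2 * q dvd int N - p'\<^sup>2" .
  have sga: "sg a = (p', q)" by (simp add: sg_def b_def p'_def a)
  show "sg a \<in> reduced"
    using red dv p'r low up by (simp add: sga reduced_def) (simp add: p'_def)
  \<comment> \<open>The new surd is b + (r - p) / q with the fraction in (0, 1), so the second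
    application uses the same b.\<close>
  have "\<lfloor>surd (p', q)\<rfloor> = b"
  proof (rule floor_unique)
    show "of_int b \<le> surd (p', q)" "surd (p', q) < of_int b + 1"
      using red by (simp_all add: surd_def p'_def field_simps)
  qed
  then show "sg (sg a) = a" by (simp add: sga) (simp add: sg_def p'_def a)
qed

lemma ta_snd:
  assumes "a \<in> reduced"
  shows "snd (ta a) * snd a = int N - (fst a)\<^sup>2"
proof -
  have "snd a dvd int N - (fst a)\<^sup>2"
    using assms by (auto simp: reduced_def intro: dvd_mult_right)
  then show ?thesis by (simp add: ta_def)
qed

text \<open>From q' q = (r - p) (r + p), the lower and upper bounds on q become the upper and lower
  bounds on q'. Evenness of q and divisibility by 2 q exchange roles in the same way.\<close>

lemma ta_reduced:
  assumes "a \<in> reduced"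
  shows "ta a \<in> reduced" "ta (ta a) = a"
proof -
  obtain p q where a: "a = (p, q)" by force
  define q' where "q' = (int N - p\<^sup>2) div q"
  have red: "0 < q" "odd p" "even q" "2 * q dvd int N - p\<^sup>2" "of_int p < r"
      "r - of_int p < of_int q" "of_int q < r + of_int p"
    using assms by (auto simp: a reduced_def)
  have taa: "ta a = (p, q')" by (simp add: ta_def q'_def a)
  have q': "int N - p\<^sup>2 = q' * q" using ta_snd[OF assms] taa by (simp add: a)
  have ev: "even q'" using red(1,4) by (simp add: q')
  have dv: "2 * q' dvd int N - p\<^sup>2" using red(3) by (auto simp: q')
  have "real_of_int (int N - p\<^sup>2) = of_int q' * of_int q" unfolding q' by simp
  then have f: "of_int q' * of_int q = (r - of_int p) * (r + of_int p)"
    using r_sq by (simp add: algebra_simps power2_eq_square)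
  have pos: "r - of_int p > 0" "r + of_int p > 0" "real_of_int q > 0" using red by simp_all
  then have "of_int q' * real_of_int q > 0" unfolding f by simp
  then have q'0: "real_of_int q' > 0" using pos(3) by (simp add: zero_less_mult_iff)
  have "of_int q' * real_of_int q < real_of_int q * (r + of_int p)"
    unfolding f using pos red(6) by (intro mult_strict_right_mono) auto
  then have up: "of_int q' < r + of_int p" using pos by (simp add: mult.commute)
  have "(r - of_int p) * real_of_int q < of_int q' * real_of_int q"
    unfolding f using pos red(7) by (intro mult_strict_left_mono) auto
  then have low: "r - of_int p < of_int q'" using pos by simp
  show "ta a \<in> reduced"
    using red(2,5) q'0 ev dv up low by (simp add: taa reduced_def)
  show "ta (ta a) = a" using q'0 by (simp add: taa) (simp add: ta_def q' a)
qed

text \<open>The fractional part is (r - p') / q with p' taken from \<open>sg\<close>; rationalizing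
  its reciprocal is what \<open>ta\<close> does.\<close>

lemma cf_step_surd:
  assumes "a \<in> reduced"
  shows "cf_step (surd a) = surd (ta (sg a))"
proof -
  define c where "c = ta (sg a)"
  have sga: "sg a \<in> reduced" and c: "c \<in> reduced"
    using assms by (simp_all add: c_def sg_reduced ta_reduced)
  have fc: "fst c = fst (sg a)" by (simp add: c_def ta_def)
  have "snd c * snd a = int N - (fst c)\<^sup>2"
    using ta_snd[OF sga] by (simp add: c_def ta_def sg_def)
  then have "real_of_int (snd c * snd a) = of_int (int N - (fst c)\<^sup>2)" by simp
  then have f: "of_int (snd c) * of_int (snd a) = (r - of_int (fst c)) * (r + of_int (fst c))"
    using r_sq by (simp add: algebra_simps power2_eq_square)
  have pos: "real_of_int (snd a) > 0" "real_of_int (snd c) > 0" "r - of_int (fst c) > 0"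
    using assms c by (auto simp: reduced_def)
  have "surd a - of_int \<lfloor>surd a\<rfloor> = (r - of_int (fst c)) / of_int (snd a)"
    using pos unfolding fc by (simp add: sg_def surd_def field_simps)
  then have "cf_step (surd a) = of_int (snd a) / (r - of_int (fst c))"
    by (simp add: cf_step_def)
  also have "\<dots> = (r + of_int (fst c)) / of_int (snd c)"
    using pos f by (simp add: field_simps)
  finally show ?thesis by (simp add: surd_def c_def)
qed

section \<open>The pair of the normalized square root\<close>

text \<open>The first component is the largest odd integer below r.\<close>

definition base :: "int \<times> int" where
  "base = (if even \<lfloor>r\<rfloor> then \<lfloor>r\<rfloor> - 1 else \<lfloor>r\<rfloor>, 2)"

lemma norm_sqrt_eq: "norm_sqrt N = surd base"
  by (simp add: norm_sqrt_def surd_def base_def)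

lemma base_bounds: "of_int (fst base) < r" "r < of_int (fst base) + 2" "odd (fst base)"
proof -
  have "of_int \<lfloor>r\<rfloor> \<noteq> r" using r_irrational by (metis Rats_of_int)
  then have "of_int \<lfloor>r\<rfloor> < r" "r < of_int \<lfloor>r\<rfloor> + 1"
    using of_int_floor_le[of r] floor_correct[of r] by linarith+
  then show "of_int (fst base) < r" "r < of_int (fst base) + 2" "odd (fst base)"
    unfolding base_def fst_conv by (auto simp del: floor_less_iff) linarith+
qed

lemma base_reduced: "base \<in> reduced"
proof -
  have N4: "N mod 4 = 1" using one_mod_4 by (simp add: cong_def)
  then have "int (N mod 4) = 1" by simp
  then have "int N mod 4 = 1" by (simp only: zmod_int of_nat_numeral)
  moreover have "(fst base)\<^sup>2 mod 4 = 1"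
  proof -
    obtain k where "fst base = 2 * k + 1" using base_bounds(3) by (elim oddE)
    then have "(fst base)\<^sup>2 = 1 + 4 * (k\<^sup>2 + k)" by (simp add: power2_eq_square algebra_simps)
    then show ?thesis by (simp only: mod_mult_self2) simp
  qed
  ultimately have dv: "4 dvd int N - (fst base)\<^sup>2" by (metis mod_eq_dvd_iff)
  \<comment> \<open>This gives r >= 2, so that p > r - 2 yields p > 0.\<close>
  have "N \<ge> 4"
  proof (rule ccontr)
    assume "\<not> N \<ge> 4"
    then have "N mod 4 = N" by simp
    then show False using N_gt_1 N4 by simp
  qed
  then have "2 \<le> r" by (simp add: real_le_rsqrt)
  then have "fst base > 0" using base_bounds(2) by simp
  then have "fst base \<ge> 1" by simp
  moreover have "snd base = 2" by (simp add: base_def)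
  ultimately show ?thesis using base_bounds dv
    unfolding reduced_def by (cases base) simp
qed

text \<open>The interval (r - 2, r) contains only one odd integer. This serves both to see that
  \<open>sg\<close> fixes \<open>base\<close> and to separate Q_s from Q_0.\<close>

lemma base_unique:
  assumes "a \<in> reduced" "snd a = 2"
  shows "a = base"
proof -
  have a: "of_int (fst a) < r" "r < of_int (fst a) + 2" "odd (fst a)"
    using assms by (auto simp: reduced_def)
  have "real_of_int (fst a) < of_int (fst base + 2)" "real_of_int (fst base) < of_int (fst a + 2)"
    using a base_bounds by simp_all
  then have "fst a < fst base + 2" "fst base < fst a + 2" by linarith+
  then have "fst a = fst base" using a(3) base_bounds(3) by presburger
  then show ?thesis using assms by (simp add: base_def prod_eq_iff)
qed

sublocale dihedral_orbit reduced sg ta base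
proof
  show "sg base = base"
    using sg_reduced(1)[OF base_reduced]
    by (rule base_unique) (simp add: sg_def base_def)
qed (rule finite_reduced base_reduced | erule sg_reduced ta_reduced)+

section \<open>Identification of the continued fraction with the orbit\<close>

lemma orb_snd_pos: "snd (orb i) > 0"
  using orb_in[of i] by (auto simp: reduced_def)

text \<open>\<open>ta\<close> keeps the first component and maps \<open>orb (- i)\<close> to
  \<open>orb (i + 1)\<close>.\<close>

lemma fst_orb_succ: "fst (orb (i + 1)) = fst (orb (- i))"
  using tau_sigma_orb[of i] sigma_orb[of i] by (simp add: ta_def flip: tau_sigma_orb)

lemma snd_orb_minus: "snd (orb (- i)) = snd (orb i)"
  by (simp add: sg_def flip: sigma_orb)

lemma cf_step_iterate: "(cf_step ^^ n) (surd base) = surd (orb (int n))"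
proof (induction n)
  case (Suc n)
  then show ?case
    using cf_step_surd[OF orb_in[of "int n"]] tau_sigma_orb[of "int n"]
    by (simp add: add.commute)
qed (simp add: orb_0)

lemma fwd_eq: "fwd N n = surd (orb (int n))"
  by (simp add: fwd_def norm_sqrt_eq cf_step_iterate)

lemma surd_pair_orb: "surd_pair N (surd (orb i)) = orb i"
  using orb_snd_pos[of i] by (simp add: surd_pair_surd)

text \<open>The reversed expansion starts from \<open>\<sigma> base = base\<close>, so it coincides with the forward one.\<close>

lemma bwd_eq: "bwd N n = surd (orb (int n))"
proof -
  have "fst (orb 1) = fst base" using fst_orb_succ[of 0] by (simp add: orb_0)
  then have "bwd N n = (cf_step ^^ n) (surd base)"
    using surd_pair_orb[of 1] surd_pair_orb[of 0]
    by (simp add: bwd_def fwd_eq orb_0 surd_def)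
  then show ?thesis by (simp add: cf_step_iterate)
qed

lemma cfQ_eq: "cfQ N i = snd (orb i)"
  using snd_orb_minus[of i] by (simp add: cfQ_def fwd_eq bwd_eq surd_pair_orb)

text \<open>For i < -1 the value comes from the reversed expansion at index -i, and
  \<open>fst_orb_succ\<close> moves it to i + 1.\<close>

lemma cfP_eq: "cfP N i = fst (orb (i + 1))"
  using fst_orb_succ[of i] by (simp add: cfP_def fwd_eq bwd_eq surd_pair_orb)

lemma cfx_eq: "cfx N i = surd (orb i)"
  by (simp add: cfx_def fwd_eq cfP_eq cfQ_eq surd_def)

lemma cfx_eq_iff: "cfx N i = cfx N j \<longleftrightarrow> orb i = orb j"
  unfolding cfx_eq by (metis surd_pair_orb)

lemma cf_period_eq: "cf_period N = per"
  by (simp add: cf_period_def per_def cfx_eq_iff period_iff)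

section \<open>Centres of symmetry for even and odd period\<close>

lemma even_period:
  assumes s: "int per = 2 * s"
  shows "snd (orb (s + i)) = snd (orb (s - i))"
    and "snd (orb s) \<noteq> 2"
    and "fst (orb (s + 1)) = fst (orb s)"
    and "snd (orb s) dvd 2 * int N"
proof -
  show "snd (orb (s + i)) = snd (orb (s - i))"
    by (simp add: sg_def flip: orb_reflect_even[OF s])
  show "snd (orb s) \<noteq> 2"
  proof
    assume "snd (orb s) = 2"
    \<comment> \<open>The orbit would return to \<open>base\<close> at index s with 0 < s <
      \<open>per\<close>, against minimality.\<close>
    then have "orb (int (nat s)) = base"
      using base_unique[OF orb_in] per_pos s by simp
    then have "per \<le> nat s"
      by (rule per_least) (use per_pos s in simp)
    then show False using per_pos s by simp
  qed
  have fixed: "sg (orb s) = orb s" using orb_reflect_even[OF s, of 0] by simp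
  then have "orb (s + 1) = ta (orb s)" using tau_sigma_orb[of s] by simp
  then show "fst (orb (s + 1)) = fst (orb s)" by (simp add: ta_def)
  define p q where "p = fst (orb s)" and "q = snd (orb s)"
  have "\<lfloor>surd (orb s)\<rfloor> * q - p = p" using fixed by (simp add: sg_def prod_eq_iff p_def q_def)
  \<comment> \<open>Thus q divides 2 p^2 as well as N - p^2, hence 2 N.\<close>
  then have "2 * p = \<lfloor>surd (orb s)\<rfloor> * q" by simp
  then have "q dvd 2 * p" by simp
  then have "q dvd 2 * p * p" by (rule dvd_mult2)
  moreover have "q dvd int N - p\<^sup>2"
    using ta_snd[OF orb_in[of s]] unfolding p_def q_def by (metis dvd_triv_right)
  ultimately have "q dvd 2 * (int N - p\<^sup>2) + 2 * p * p" by (metis dvd_add dvd_mult)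
  also have "2 * (int N - p\<^sup>2) + 2 * p * p = 2 * int N" by (simp add: power2_eq_square)
  finally show "snd (orb s) dvd 2 * int N" by (simp add: q_def)
qed

lemma odd_period:
  assumes s: "int per = 2 * s + 1"
  shows "snd (orb (s + i + 1)) = snd (orb (s - i))"
    and "1 < gcd (snd (orb s)) (int N) \<and> gcd (snd (orb s)) (int N) < int N \<or>
         QuadRes (int N) (- 1)"
proof -
  show refl: "snd (orb (s + i + 1)) = snd (orb (s - i))" for i
    by (simp add: sg_def flip: orb_reflect_odd[OF s])
  define p q where "p = fst (orb (s + 1))" and "q = snd (orb s)"
  have q: "snd (orb (s + 1)) = q" using refl[of 0] by (simp add: q_def)
  \<comment> \<open>\<open>ta\<close> acts on indices by i to 1 - i, which sends s + 1 to -s, the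
    same index modulo the period.\<close>
  have "ta (orb (s + 1)) = orb (s + 1)"
    using orb_add_per[of "- s"] s by (simp add: tau_orb algebra_simps)
  then have Npq: "int N = p\<^sup>2 + q\<^sup>2"
    using ta_snd[OF orb_in[of "s + 1"]] q by (simp add: p_def power2_eq_square)
  have q0: "q > 0" using orb_snd_pos by (simp add: q_def)
  \<comment> \<open>Oddness excludes p = 0, so q <= q^2 < N and the gcd cannot be N itself.\<close>
  have "odd p" using orb_in[of "s + 1"] by (auto simp: reduced_def p_def)
  then have "p\<^sup>2 > 0" by auto
  then have "q\<^sup>2 < int N" using Npq by simp
  moreover have "q \<le> q\<^sup>2" using q0 by (simp add: power2_eq_square)
  ultimately have lt: "gcd q (int N) < int N"
    using gcd_le1_int[OF q0, of "int N"] by linarith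
  show "1 < gcd (snd (orb s)) (int N) \<and> gcd (snd (orb s)) (int N) < int N \<or>
         QuadRes (int N) (- 1)"
  proof (cases "gcd q (int N) = 1")
    case False
    moreover have "gcd q (int N) > 0" using q0 by simp
    ultimately have "1 < gcd q (int N)" by linarith
    then show ?thesis using lt by (simp add: q_def)
  next
    case True
    \<comment> \<open>With u the inverse of q modulo N, p^2 = N - q^2 makes p u a square root of
      -1.\<close>
    then obtain u where u: "[q * u = 1] (mod int N)"
      using cong_solve_coprime_int[of q "int N"] by (auto simp: coprime_iff_gcd_eq_1)
    have "[(q * u)\<^sup>2 = 1\<^sup>2] (mod int N)" by (rule cong_pow[OF u])
    then have "int N dvd (q * u)\<^sup>2 - 1" by (simp add: cong_iff_dvd_diff)
    then have "int N dvd int N * u\<^sup>2 - ((q * u)\<^sup>2 - 1)" by (rule dvd_diff[OF dvd_triv_left])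
    also have "int N * u\<^sup>2 - ((q * u)\<^sup>2 - 1) = (p * u)\<^sup>2 - (- 1)"
      by (simp add: Npq power2_eq_square algebra_simps)
    finally have "[(p * u)\<^sup>2 = - 1] (mod int N)" by (simp add: cong_iff_dvd_diff)
    then show ?thesis by (auto simp: QuadRes_def)
  qed
qed

end

theorem theorem2p9:
  fixes N \<pi> :: nat and s :: int
  assumes "N > 0"
    and "\<nexists>k::nat. N = k\<^sup>2"
    and "[N = 1] (mod 4)"
    and "\<pi> = cf_period N"
    and "s = int (\<pi> div 2)"
  shows "(even \<pi> \<longrightarrow>
            (\<forall>i::int. cfQ N (s + i) = cfQ N (s - i)) \<and>
            cfQ N s \<noteq> cfQ N 0 \<and>
            cfP N s = cfP N (s - 1) \<and>
            cfQ N s dvd 2 * int N) \<and>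
         (odd \<pi> \<longrightarrow>
            (\<forall>i::int. cfQ N (s + i + 1) = cfQ N (s - i)) \<and>
            (1 < gcd (cfQ N s) (int N) \<and> gcd (cfQ N s) (int N) < int N \<or>
             QuadRes (int N) (- 1)))"
proof -
  interpret reduced_surds N by unfold_locales (use assms in auto)
  have per: "\<pi> = per" using assms(4) by (simp add: cf_period_eq)
  have Q0: "cfQ N 0 = 2" unfolding cfQ_eq orb_0 by (simp add: base_def)
  show ?thesis
  proof (intro conjI impI)
    assume "even \<pi>"
    then have "int per = 2 * s" using assms(5) per by auto
    from even_period[OF this]
    show "\<forall>i. cfQ N (s + i) = cfQ N (s - i)" "cfQ N s \<noteq> cfQ N 0"
      "cfP N s = cfP N (s - 1)" "cfQ N s dvd 2 * int N"
      by (simp_all add: Q0) (simp_all add: cfQ_eq cfP_eq)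
  next
    assume "odd \<pi>"
    then have "int per = 2 * s + 1" using assms(5) per by presburger
    from odd_period[OF this]
    show "\<forall>i. cfQ N (s + i + 1) = cfQ N (s - i)"
      "1 < gcd (cfQ N s) (int N) \<and> gcd (cfQ N s) (int N) < int N \<or> QuadRes (int N) (- 1)"
      by (simp_all add: cfQ_eq)
  qed
qed

end
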